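(* Let $\mathscr A$ be a profinitary cofinitary exact category. For $\gamma\in\Gamma_{\mathscr A}^+=\Gamma_{\mathscr A}\setminus\{0\}$ put $m_\gamma:=\#\mathrm{Ind}\,\mathscr A_\gamma-\dim_{\mathbb Q}(V_{\mathscr A})_\gamma$, where $V_{\mathscr A}$ is the space of primitive elements of the Hall algebra $H_{\mathscr A}$. Then $m_\gamma\ge 0$ for all $\gamma\in\Gamma_{\mathscr A}^+$.
   Context: All categories are essentially small; exact categories are in the sense of Quillen. $\mathrm{Iso}\,\mathscr A$ is the set of isomorphism classes $[X]$ of objects, an abelian monoid under $\oplus$. $\underline{\mathrm{Ext}}^1_{\mathscr A}(A,B)$ is the set of all $[X]$ such that there is a short exact sequence $B\rightarrowtail X\twoheadrightarrow A$. The Grothendieck monoid $\Gamma_{\mathscr A}$ is the quotient of $\mathrm{Iso}\,\mathscr A$ by the congruence which is the transitive closure of: $[X]\equiv[Y]$ if $[X],[Y]\in\underline{\mathrm{Ext}}^1_{\mathscr A}(M,N)$ for some $M,N$; $|X|$ is the image of $X$ in $\Gamma_{\mathscr A}$, $\mathrm{Iso}\,\mathscr A_\gamma=\{[X]:|X|=\gamma\}$, and $\mathrm{Ind}\,\mathscr A_\gamma$ is the set of classes of indecomposable objects in $\mathrm{Iso}\,\mathscr A_\gamma$. A Hom-finite exact category (all Hom sets finite) is profinitary if $\mathrm{Iso}\,\mathscr A_\gamma$ is finite for all $\gamma$, and cofinitary if for every $[X]$ there are finitely many pairs $([A],[B])$ with $[X]\in\underline{\mathrm{Ext}}^1_{\mathscr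 A}(A,B)$. Let $\mathcal E(A,B)_X$ be the set of all short exact sequences $B\rightarrowtail X\twoheadrightarrow A$ and $F_{A,B}^X=\#\mathcal E(A,B)_X/(\#\mathrm{Aut}\,A\cdot\#\mathrm{Aut}\,B)$. The Hall algebra $H_{\mathscr A}$ is the $\mathbb Q$-vector space with basis $\mathrm{Iso}\,\mathscr A$, product $[A]\cdot[B]=\sum_{[C]}F_{A,B}^C[C]$, unit $1=[0]$, coproduct $\Delta([C])=\sum_{[A],[B]}F^{A,B}_C\,[A]\otimes[B]$ with $F^{A,B}_C=\frac{\#\mathrm{Aut}\,A\cdot\#\mathrm{Aut}\,B}{\#\mathrm{Aut}\,C}F_{B,A}^C$. It is $\Gamma_{\mathscr A}$-graded by $[M]\mapsto|M|$. $V_{\mathscr A}=\{v\in H_{\mathscr A}:\Delta(v)=v\otimes1+1\otimes v\}$ is a graded subspace, and $(V_{\mathscr A})_\gamma$ is its component of degree $\gamma$. *)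

theory Defs
  imports Complex_Main "HOL-Algebra.Group" "HOL-Library.Poly_Mapping"
begin

section \<open>Exact categories in the sense of Quillen\<close>

text \<open>
  Categories are given by a set of objects and a set of arrows inside arbitrary types, hence are
  small.  Composition is written in the usual order: \<open>g \<cdot> f\<close> is \<open>f\<close> followed by \<open>g\<close>.
\<close>

record ('o, 'm) category =
  Ob :: "'o set"
  Arr :: "'m set"
  Src :: "'m \<Rightarrow> 'o"
  Tgt :: "'m \<Rightarrow> 'o"
  Ident :: "'o \<Rightarrow> 'm"
  Comp :: "'m \<Rightarrow> 'm \<Rightarrow> 'm" (infixl \<open>\<cdot>\<index>\<close> 70)

record ('o, 'm) additive_category = "('o, 'm) category" +
  Plus :: "'m \<Rightarrow> 'm \<Rightarrow> 'm"
  Zero :: "'o \<Rightarrow> 'o \<Rightarrow> 'm"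

text \<open>\<open>SES\<close> is the class of short exact sequences; \<open>B \<rightarrow>\<^sup>i X \<rightarrow>\<^sup>p A\<close> is recorded as \<open>(i, p)\<close>.\<close>

record ('o, 'm) exact_category = "('o, 'm) additive_category" +
  SES :: "('m \<times> 'm) set"

definition Hom :: "('o, 'm, 'x) category_scheme \<Rightarrow> 'o \<Rightarrow> 'o \<Rightarrow> 'm set" where
  "Hom C A B = {f \<in> Arr C. Src C f = A \<and> Tgt C f = B}"

locale category =
  fixes C :: "('o, 'm, 'x) category_scheme" (structure)
  assumes Src_closed: "f \<in> Arr C \<Longrightarrow> Src C f \<in> Ob C"
    and Tgt_closed: "f \<in> Arr C \<Longrightarrow> Tgt C f \<in> Ob C"
    and Ident_closed: "A \<in> Ob C \<Longrightarrow> Ident C A \<in> Hom C A A"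
    and Comp_closed: "f \<in> Hom C A B \<Longrightarrow> g \<in> Hom C B D \<Longrightarrow> g \<cdot> f \<in> Hom C A D"
    and Comp_Ident: "f \<in> Hom C A B \<Longrightarrow> f \<cdot> Ident C A = f"
    and Ident_Comp: "f \<in> Hom C A B \<Longrightarrow> Ident C B \<cdot> f = f"
    and Comp_assoc: "f \<in> Hom C A B \<Longrightarrow> g \<in> Hom C B D \<Longrightarrow> h \<in> Hom C D E \<Longrightarrow>
          (h \<cdot> g) \<cdot> f = h \<cdot> (g \<cdot> f)"

definition is_iso :: "('o, 'm, 'x) category_scheme \<Rightarrow> 'o \<Rightarrow> 'o \<Rightarrow> 'm \<Rightarrow> bool" where
  "is_iso C A B f \<longleftrightarrow> f \<in> Hom C A B \<and>
     (\<exists>g \<in> Hom C B A. g \<cdot>\<^bsub>C\<^esub> f = Ident C A \<and> f \<cdot>\<^bsub>C\<^esub> g = Ident C B)"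

definition is_zero_object :: "('o, 'm, 'x) category_scheme \<Rightarrow> 'o \<Rightarrow> bool" where
  "is_zero_object C Z \<longleftrightarrow> Z \<in> Ob C \<and>
     (\<forall>A \<in> Ob C. (\<exists>!f. f \<in> Hom C A Z) \<and> (\<exists>!f. f \<in> Hom C Z A))"

definition is_pullback ::
    "('o, 'm, 'x) category_scheme \<Rightarrow> 'o \<Rightarrow> 'o \<Rightarrow> 'o \<Rightarrow> 'o \<Rightarrow> 'm \<Rightarrow> 'm \<Rightarrow> 'm \<Rightarrow> 'm \<Rightarrow> bool" where
  \<comment> \<open>the square with sides \<open>p : X \<rightarrow> A\<close>, \<open>f : A' \<rightarrow> A\<close>, \<open>p' : X' \<rightarrow> A'\<close>, \<open>f' : X' \<rightarrow> X\<close>\<close>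
  "is_pullback C X A X' A' p f p' f' \<longleftrightarrow>
     p \<in> Hom C X A \<and> f \<in> Hom C A' A \<and> p' \<in> Hom C X' A' \<and> f' \<in> Hom C X' X \<and>
     p \<cdot>\<^bsub>C\<^esub> f' = f \<cdot>\<^bsub>C\<^esub> p' \<and>
     (\<forall>T \<in> Ob C. \<forall>u \<in> Hom C T X. \<forall>v \<in> Hom C T A'. p \<cdot>\<^bsub>C\<^esub> u = f \<cdot>\<^bsub>C\<^esub> v \<longrightarrow>
        (\<exists>!w. w \<in> Hom C T X' \<and> f' \<cdot>\<^bsub>C\<^esub> w = u \<and> p' \<cdot>\<^bsub>C\<^esub> w = v))"

definition is_pushout ::
    "('o, 'm, 'x) category_scheme \<Rightarrow> 'o \<Rightarrow> 'o \<Rightarrow> 'o \<Rightarrow> 'o \<Rightarrow> 'm \<Rightarrow> 'm \<Rightarrow> 'm \<Rightarrow> 'm \<Rightarrow> bool" where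
  \<comment> \<open>the square with sides \<open>i : B \<rightarrow> X\<close>, \<open>f : B \<rightarrow> B'\<close>, \<open>i' : B' \<rightarrow> X'\<close>, \<open>f' : X \<rightarrow> X'\<close>\<close>
  "is_pushout C B X B' X' i f i' f' \<longleftrightarrow>
     i \<in> Hom C B X \<and> f \<in> Hom C B B' \<and> i' \<in> Hom C B' X' \<and> f' \<in> Hom C X X' \<and>
     f' \<cdot>\<^bsub>C\<^esub> i = i' \<cdot>\<^bsub>C\<^esub> f \<and>
     (\<forall>T \<in> Ob C. \<forall>u \<in> Hom C X T. \<forall>v \<in> Hom C B' T. u \<cdot>\<^bsub>C\<^esub> i = v \<cdot>\<^bsub>C\<^esub> f \<longrightarrow>
        (\<exists>!w. w \<in> Hom C X' T \<and> w \<cdot>\<^bsub>C\<^esub> f' = u \<and> w \<cdot>\<^bsub>C\<^esub> i' = v))"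

definition is_biproduct ::
    "('o, 'm, 'x) additive_category_scheme \<Rightarrow> 'o \<Rightarrow> 'o \<Rightarrow> 'o \<Rightarrow> 'm \<Rightarrow> 'm \<Rightarrow> 'm \<Rightarrow> 'm \<Rightarrow> bool" where
  "is_biproduct C A B S i j p q \<longleftrightarrow>
     i \<in> Hom C A S \<and> j \<in> Hom C B S \<and> p \<in> Hom C S A \<and> q \<in> Hom C S B \<and>
     p \<cdot>\<^bsub>C\<^esub> i = Ident C A \<and> q \<cdot>\<^bsub>C\<^esub> j = Ident C B \<and>
     q \<cdot>\<^bsub>C\<^esub> i = Zero C A B \<and> p \<cdot>\<^bsub>C\<^esub> j = Zero C B A \<and>
     Plus C (i \<cdot>\<^bsub>C\<^esub> p) (j \<cdot>\<^bsub>C\<^esub> q) = Ident C S"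

locale additive_category = category C
  for C :: "('o, 'm, 'x) additive_category_scheme" (structure) +
  assumes Hom_group: "A \<in> Ob C \<Longrightarrow> B \<in> Ob C \<Longrightarrow>
          comm_group \<lparr>carrier = Hom C A B, monoid.mult = Plus C, one = Zero C A B\<rparr>"
    and Comp_Plus_left: "f \<in> Hom C A B \<Longrightarrow> g \<in> Hom C B D \<Longrightarrow> h \<in> Hom C B D \<Longrightarrow>
          Plus C g h \<cdot> f = Plus C (g \<cdot> f) (h \<cdot> f)"
    and Comp_Plus_right: "f \<in> Hom C A B \<Longrightarrow> g \<in> Hom C A B \<Longrightarrow> h \<in> Hom C B D \<Longrightarrow>
          h \<cdot> Plus C f g = Plus C (h \<cdot> f) (h \<cdot> g)"
    and ex_zero_object: "\<exists>Z. is_zero_object C Z"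
    and ex_biproduct: "A \<in> Ob C \<Longrightarrow> B \<in> Ob C \<Longrightarrow> \<exists>S i j p q. S \<in> Ob C \<and> is_biproduct C A B S i j p q"

definition is_kernel ::
    "('o, 'm, 'x) additive_category_scheme \<Rightarrow> 'o \<Rightarrow> 'o \<Rightarrow> 'o \<Rightarrow> 'm \<Rightarrow> 'm \<Rightarrow> bool" where
  "is_kernel C B X A i p \<longleftrightarrow>
     i \<in> Hom C B X \<and> p \<in> Hom C X A \<and> p \<cdot>\<^bsub>C\<^esub> i = Zero C B A \<and>
     (\<forall>T \<in> Ob C. \<forall>u \<in> Hom C T X. p \<cdot>\<^bsub>C\<^esub> u = Zero C T A \<longrightarrow>
        (\<exists>!w. w \<in> Hom C T B \<and> i \<cdot>\<^bsub>C\<^esub> w = u))"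

definition is_cokernel ::
    "('o, 'm, 'x) additive_category_scheme \<Rightarrow> 'o \<Rightarrow> 'o \<Rightarrow> 'o \<Rightarrow> 'm \<Rightarrow> 'm \<Rightarrow> bool" where
  "is_cokernel C B X A i p \<longleftrightarrow>
     i \<in> Hom C B X \<and> p \<in> Hom C X A \<and> p \<cdot>\<^bsub>C\<^esub> i = Zero C B A \<and>
     (\<forall>T \<in> Ob C. \<forall>u \<in> Hom C X T. u \<cdot>\<^bsub>C\<^esub> i = Zero C B T \<longrightarrow>
        (\<exists>!w. w \<in> Hom C A T \<and> w \<cdot>\<^bsub>C\<^esub> p = u))"

text \<open>The set \<open>\<E>(A,B)\<^sub>X\<close> of short exact sequences \<open>B \<rightarrow> X \<rightarrow> A\<close>.\<close>

definition ses_set :: "('o, 'm, 'x) exact_category_scheme \<Rightarrow> 'o \<Rightarrow> 'o \<Rightarrow> 'o \<Rightarrow> ('m \<times> 'm) set" where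
  "ses_set C A B X = {(i, p) \<in> SES C. i \<in> Hom C B X \<and> p \<in> Hom C X A}"

definition adm_mono :: "('o, 'm, 'x) exact_category_scheme \<Rightarrow> 'm \<Rightarrow> bool" where
  "adm_mono C i \<longleftrightarrow> (\<exists>p. (i, p) \<in> SES C)"

definition adm_epi :: "('o, 'm, 'x) exact_category_scheme \<Rightarrow> 'm \<Rightarrow> bool" where
  "adm_epi C p \<longleftrightarrow> (\<exists>i. (i, p) \<in> SES C)"

text \<open>
  Quillen's axioms.  His last one (on maps possessing a kernel or a cokernel) is omitted, as usual:
  it follows from the others (Yoneda, Keller).
\<close>

locale exact_category = additive_category C
  for C :: "('o, 'm, 'x) exact_category_scheme" (structure) +
  assumes SES_kernel_cokernel: "(i, p) \<in> SES C \<Longrightarrow>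
          \<exists>A \<in> Ob C. \<exists>B \<in> Ob C. \<exists>X \<in> Ob C. is_kernel C B X A i p \<and> is_cokernel C B X A i p"
    and SES_iso_closed: "(i, p) \<in> ses_set C A B X \<Longrightarrow> i' \<in> Hom C B' X' \<Longrightarrow> p' \<in> Hom C X' A' \<Longrightarrow>
          is_iso C A A' a \<Longrightarrow> is_iso C B B' b \<Longrightarrow> is_iso C X X' x \<Longrightarrow>
          x \<cdot> i = i' \<cdot> b \<Longrightarrow> a \<cdot> p = p' \<cdot> x \<Longrightarrow> (i', p') \<in> SES C"
    and SES_split: "A \<in> Ob C \<Longrightarrow> B \<in> Ob C \<Longrightarrow> S \<in> Ob C \<Longrightarrow> is_biproduct C A B S i j p q \<Longrightarrow>
          (i, q) \<in> SES C"
    and adm_mono_Comp: "adm_mono C i \<Longrightarrow> adm_mono C j \<Longrightarrow> Tgt C i = Src C j \<Longrightarrow> adm_mono C (j \<cdot> i)"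
    and adm_epi_Comp: "adm_epi C p \<Longrightarrow> adm_epi C q \<Longrightarrow> Tgt C p = Src C q \<Longrightarrow> adm_epi C (q \<cdot> p)"
    and adm_mono_cobase_change: "adm_mono C i \<Longrightarrow> i \<in> Hom C B X \<Longrightarrow> f \<in> Hom C B B' \<Longrightarrow>
          \<exists>X' i' f'. is_pushout C B X B' X' i f i' f' \<and> adm_mono C i'"
    and adm_epi_base_change: "adm_epi C p \<Longrightarrow> p \<in> Hom C X A \<Longrightarrow> f \<in> Hom C A' A \<Longrightarrow>
          \<exists>X' p' f'. is_pullback C X A X' A' p f p' f' \<and> adm_epi C p'"

section \<open>Isomorphism classes and the Grothendieck monoid\<close>

definition iso_rel :: "('o, 'm, 'x) category_scheme \<Rightarrow> ('o \<times> 'o) set" where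
  "iso_rel C = {(A, B). A \<in> Ob C \<and> B \<in> Ob C \<and> (\<exists>f. is_iso C A B f)}"

definition iso_class :: "('o, 'm, 'x) category_scheme \<Rightarrow> 'o \<Rightarrow> 'o set" where
  "iso_class C X = iso_rel C `` {X}"

text \<open>
  The monoid \<open>Iso \<A>\<close> under direct sum.  The class of all direct sums of members of two isomorphism
  classes, and the class of all zero objects, are isomorphism classes.
\<close>

definition Iso :: "('o, 'm, 'x) additive_category_scheme \<Rightarrow> 'o set monoid" where
  "Iso C = \<lparr>carrier = Ob C // iso_rel C,
     monoid.mult = (\<lambda>a b. {S \<in> Ob C. \<exists>A \<in> a. \<exists>B \<in> b. \<exists>i j p q. is_biproduct C A B S i j p q}),
     one = {Z. is_zero_object C Z}\<rparr>"

definition Ext1 :: "('o, 'm, 'x) exact_category_scheme \<Rightarrow> 'o \<Rightarrow> 'o \<Rightarrow> 'o set set" where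
  "Ext1 C A B = {iso_class C X | X. X \<in> Ob C \<and> ses_set C A B X \<noteq> {}}"

definition groth_cong :: "('o, 'm, 'x) exact_category_scheme \<Rightarrow> ('o set \<times> 'o set) set" where
  "groth_cong C = {(x, y). \<exists>M \<in> Ob C. \<exists>N \<in> Ob C. x \<in> Ext1 C M N \<and> y \<in> Ext1 C M N}\<^sup>+"

definition groth_monoid :: "('o, 'm, 'x) exact_category_scheme \<Rightarrow> 'o set set monoid" where
  "groth_monoid C = \<lparr>carrier = carrier (Iso C) // groth_cong C,
     monoid.mult = (\<lambda>\<gamma> \<delta>. \<Union>x \<in> \<gamma>. \<Union>y \<in> \<delta>. groth_cong C `` {x \<otimes>\<^bsub>Iso C\<^esub> y}),
     one = groth_cong C `` {\<one>\<^bsub>Iso C\<^esub>}\<rparr>"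

definition groth_class :: "('o, 'm, 'x) exact_category_scheme \<Rightarrow> 'o \<Rightarrow> 'o set set" where
  "groth_class C X = groth_cong C `` {iso_class C X}"

definition Iso_deg :: "('o, 'm, 'x) exact_category_scheme \<Rightarrow> 'o set set \<Rightarrow> 'o set set" where
  "Iso_deg C \<gamma> = {iso_class C X | X. X \<in> Ob C \<and> groth_class C X = \<gamma>}"

definition indecomposable :: "('o, 'm, 'x) additive_category_scheme \<Rightarrow> 'o \<Rightarrow> bool" where
  "indecomposable C X \<longleftrightarrow> X \<in> Ob C \<and> \<not> is_zero_object C X \<and>
     (\<forall>A \<in> Ob C. \<forall>B \<in> Ob C. \<forall>i j p q. is_biproduct C A B X i j p q \<longrightarrow>
        is_zero_object C A \<or> is_zero_object C B)"

definition Ind_deg :: "('o, 'm, 'x) exact_category_scheme \<Rightarrow> 'o set set \<Rightarrow> 'o set set" where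
  "Ind_deg C \<gamma> = {iso_class C X | X. indecomposable C X \<and> iso_class C X \<in> Iso_deg C \<gamma>}"

definition hom_finite :: "('o, 'm, 'x) category_scheme \<Rightarrow> bool" where
  "hom_finite C \<longleftrightarrow> (\<forall>A \<in> Ob C. \<forall>B \<in> Ob C. finite (Hom C A B))"

definition profinitary :: "('o, 'm, 'x) exact_category_scheme \<Rightarrow> bool" where
  "profinitary C \<longleftrightarrow> hom_finite C \<and> (\<forall>\<gamma> \<in> carrier (groth_monoid C). finite (Iso_deg C \<gamma>))"

definition cofinitary :: "('o, 'm, 'x) exact_category_scheme \<Rightarrow> bool" where
  "cofinitary C \<longleftrightarrow> hom_finite C \<and>
     (\<forall>X \<in> Ob C. finite {(iso_class C A, iso_class C B) | A B.
        A \<in> Ob C \<and> B \<in> Ob C \<and> iso_class C X \<in> Ext1 C A B})"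

section \<open>The Hall algebra\<close>

text \<open>
  The vector space with basis \<open>I\<close> over the rationals is modelled by the finitely supported functions
  \<open>'i \<Rightarrow>\<^sub>0 rat\<close> with support in \<open>I\<close>.
\<close>

definition pm_scale :: "rat \<Rightarrow> ('i \<Rightarrow>\<^sub>0 rat) \<Rightarrow> ('i \<Rightarrow>\<^sub>0 rat)" where
  "pm_scale r v = Poly_Mapping.map ((*) r) v"

lemma lookup_pm_scale: "Poly_Mapping.lookup (pm_scale r v) i = r * Poly_Mapping.lookup v i"
  by (simp add: pm_scale_def Poly_Mapping.map.rep_eq when_def)

lemma vector_space_pm_scale: "vector_space pm_scale"
  by unfold_locales
    (auto intro!: poly_mapping_eqI simp: lookup_pm_scale lookup_add algebra_simps)

definition Aut :: "('o, 'm, 'x) category_scheme \<Rightarrow> 'o \<Rightarrow> 'm set" where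
  "Aut C A = {f. is_iso C A A f}"

definition rep :: "'o set \<Rightarrow> 'o" where
  "rep a = (SOME X. X \<in> a)"

text \<open>
  \<open>hall_F C a b c\<close> is \<open>F\<^sup>X\<^bsub>A,B\<^esub>\<close> for \<open>a = [A]\<close>, \<open>b = [B]\<close>, \<open>c = [X]\<close>, and \<open>hall_coF C a b c\<close> is
  \<open>F\<^sup>A\<^sup>,\<^sup>B\<^sub>X\<close>; neither depends on the representatives.
\<close>

definition hall_F :: "('o, 'm, 'x) exact_category_scheme \<Rightarrow> 'o set \<Rightarrow> 'o set \<Rightarrow> 'o set \<Rightarrow> rat" where
  "hall_F C a b c = of_nat (card (ses_set C (rep a) (rep b) (rep c))) /
     (of_nat (card (Aut C (rep a))) * of_nat (card (Aut C (rep b))))"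

definition hall_coF :: "('o, 'm, 'x) exact_category_scheme \<Rightarrow> 'o set \<Rightarrow> 'o set \<Rightarrow> 'o set \<Rightarrow> rat" where
  "hall_coF C a b c =
     of_nat (card (Aut C (rep a))) * of_nat (card (Aut C (rep b))) / of_nat (card (Aut C (rep c))) *
     hall_F C b a c"

definition hall_space :: "('o, 'm, 'x) exact_category_scheme \<Rightarrow> ('o set \<Rightarrow>\<^sub>0 rat) set" where
  "hall_space C = {v. Poly_Mapping.keys v \<subseteq> carrier (Iso C)}"

text \<open>
  The defining sums of product and coproduct range over the nonzero terms only; in a profinitary,
  respectively cofinitary, category these are finite in number.
\<close>

definition hall_mult ::
    "('o, 'm, 'x) exact_category_scheme \<Rightarrow> ('o set \<Rightarrow>\<^sub>0 rat) \<Rightarrow> ('o set \<Rightarrow>\<^sub>0 rat) \<Rightarrow> ('o set \<Rightarrow>\<^sub>0 rat)" where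
  "hall_mult C v w = (\<Sum>a \<in> Poly_Mapping.keys v. \<Sum>b \<in> Poly_Mapping.keys w.
     pm_scale (Poly_Mapping.lookup v a * Poly_Mapping.lookup w b)
       (\<Sum>c \<in> {c \<in> carrier (Iso C). hall_F C a b c \<noteq> 0}. Poly_Mapping.single c (hall_F C a b c)))"

definition hall_one :: "('o, 'm, 'x) exact_category_scheme \<Rightarrow> ('o set \<Rightarrow>\<^sub>0 rat)" where
  "hall_one C = Poly_Mapping.single \<one>\<^bsub>Iso C\<^esub> 1"

text \<open>
  The tensor square of the space with basis \<open>Iso \<A>\<close> is the space with basis \<open>Iso \<A> \<times> Iso \<A>\<close>,
  with \<open>(a, b)\<close> standing for \<open>a \<otimes> b\<close>.
\<close>

definition tensor :: "('i \<Rightarrow>\<^sub>0 rat) \<Rightarrow> ('j \<Rightarrow>\<^sub>0 rat) \<Rightarrow> ('i \<times> 'j \<Rightarrow>\<^sub>0 rat)" where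
  "tensor v w = (\<Sum>a \<in> Poly_Mapping.keys v. \<Sum>b \<in> Poly_Mapping.keys w.
     Poly_Mapping.single (a, b) (Poly_Mapping.lookup v a * Poly_Mapping.lookup w b))"

definition hall_comult ::
    "('o, 'm, 'x) exact_category_scheme \<Rightarrow> ('o set \<Rightarrow>\<^sub>0 rat) \<Rightarrow> ('o set \<times> 'o set \<Rightarrow>\<^sub>0 rat)" where
  "hall_comult C v = (\<Sum>c \<in> Poly_Mapping.keys v. pm_scale (Poly_Mapping.lookup v c)
     (\<Sum>(a, b) \<in> {(a, b). a \<in> carrier (Iso C) \<and> b \<in> carrier (Iso C) \<and> hall_coF C a b c \<noteq> 0}.
        Poly_Mapping.single (a, b) (hall_coF C a b c)))"

definition primitive_space :: "('o, 'm, 'x) exact_category_scheme \<Rightarrow> ('o set \<Rightarrow>\<^sub>0 rat) set" where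
  "primitive_space C =
     {v \<in> hall_space C. hall_comult C v = tensor v (hall_one C) + tensor (hall_one C) v}"

definition primitive_deg ::
    "('o, 'm, 'x) exact_category_scheme \<Rightarrow> 'o set set \<Rightarrow> ('o set \<Rightarrow>\<^sub>0 rat) set" where
  "primitive_deg C \<gamma> = {v \<in> primitive_space C. Poly_Mapping.keys v \<subseteq> Iso_deg C \<gamma>}"

text \<open>
  If \<open>C\<close> is profinitary, \<open>Ind_deg C \<gamma>\<close> is finite and \<open>primitive_deg C \<gamma>\<close> is finite-dimensional, being
  contained in the respective notions for \<open>Iso_deg C \<gamma>\<close>; so the conventions on the cardinality of
  infinite sets and for the dimension of infinite-dimensional spaces play no role.
\<close>

definition mult_deg :: "('o, 'm, 'x) exact_category_scheme \<Rightarrow> 'o set set \<Rightarrow> int" where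
  "mult_deg C \<gamma> = int (card (Ind_deg C \<gamma>)) - int (vector_space.dim pm_scale (primitive_deg C \<gamma>))"

end

theory Submission
  imports Defs
begin

text \<open>
  A nonsplit extension \<open>Y\<close> of \<open>B\<close> by \<open>A\<close> has fewer endomorphisms than \<open>A \<oplus> B\<close>: left exactness of Hom
  gives \<open>|Hom(Y,Y)| \<le> |Hom(Y,A)| |Hom(Y,B)| \<le> |Hom(A,A)| |Hom(B,A)| |Hom(A,B)| |Hom(B,B)|\<close>, and
  equality would make \<open>Hom(Y,A) \<rightarrow> Hom(A,A)\<close> surjective, so that the identity of \<open>A\<close> would extend to a
  retraction.  Consequently a primitive element of nonzero degree that vanishes on the indecomposables is zero, and
  \<open>(V\<^sub>\<A>)\<^sub>\<gamma>\<close> embeds into the space with basis \<open>Ind \<A>\<^sub>\<gamma>\<close> by restriction of coefficients.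
\<close>

section \<open>Additive categories\<close>

lemma card_le_fibres:
  assumes "finite S" "\<And>x. x \<in> S \<Longrightarrow> card {y \<in> S. f y = f x} \<le> k"
  shows "card S \<le> k * card (f ` S)"
proof -
  have "card S = (\<Sum>z \<in> f ` S. card {y \<in> S. f y = z})"
    using sum.image_gen[OF assms(1), of "\<lambda>_. 1::nat" f] by simp
  also have "\<dots> \<le> (\<Sum>z \<in> f ` S. k)" using assms by (intro sum_mono) auto
  finally show ?thesis by (simp add: mult.commute)
qed

context additive_category
begin

section \<open>Arithmetic in the groups of morphisms\<close>

lemma Hom_ObD: "f \<in> Hom C A B \<Longrightarrow> A \<in> Ob C" "f \<in> Hom C A B \<Longrightarrow> B \<in> Ob C"
  using Src_closed Tgt_closed by (auto simp: Hom_def)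

lemma Plus_closed: "f \<in> Hom C A B \<Longrightarrow> g \<in> Hom C A B \<Longrightarrow> Plus C f g \<in> Hom C A B"
  using comm_groupE(1)[OF Hom_group[OF Hom_ObD(1) Hom_ObD(2)]] by fastforce

lemma Zero_closed: "A \<in> Ob C \<Longrightarrow> B \<in> Ob C \<Longrightarrow> Zero C A B \<in> Hom C A B"
  using comm_groupE(2)[OF Hom_group] by fastforce

lemma Plus_assoc: "f \<in> Hom C A B \<Longrightarrow> g \<in> Hom C A B \<Longrightarrow> h \<in> Hom C A B \<Longrightarrow>
    Plus C (Plus C f g) h = Plus C f (Plus C g h)"
  using comm_groupE(3)[OF Hom_group[OF Hom_ObD(1) Hom_ObD(2)]] by fastforce

lemma Plus_comm: "f \<in> Hom C A B \<Longrightarrow> g \<in> Hom C A B \<Longrightarrow> Plus C f g = Plus C g f"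
  using comm_groupE(4)[OF Hom_group[OF Hom_ObD(1) Hom_ObD(2)]] by fastforce

lemma Zero_Plus: "f \<in> Hom C A B \<Longrightarrow> Plus C (Zero C A B) f = f"
  using comm_groupE(5)[OF Hom_group[OF Hom_ObD(1) Hom_ObD(2)]] by fastforce

lemma Plus_Zero: "f \<in> Hom C A B \<Longrightarrow> Plus C f (Zero C A B) = f"
  by (metis Hom_ObD Plus_comm Zero_Plus Zero_closed)

lemma ex_Neg: "f \<in> Hom C A B \<Longrightarrow> \<exists>g \<in> Hom C A B. Plus C f g = Zero C A B"
  using comm_groupE(6)[OF Hom_group[OF Hom_ObD(1) Hom_ObD(2)]] Plus_comm by fastforce

text \<open>The signature has no subtraction; the witness \<open>d\<close> stands in for
  \<open>f - g\<close> wherever a difference of morphisms is wanted.\<close>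

lemma ex_diff:
  assumes "f \<in> Hom C A B" "g \<in> Hom C A B"
  shows "\<exists>d \<in> Hom C A B. f = Plus C g d"
proof -
  obtain n where n: "n \<in> Hom C A B" "Plus C g n = Zero C A B" using ex_Neg assms by blast
  have "f = Plus C g (Plus C n f)"
    using n assms by (simp add: Zero_Plus flip: Plus_assoc)
  with n assms Plus_closed show ?thesis by blast
qed

lemma Plus_cancel:
  assumes "f \<in> Hom C A B" "g \<in> Hom C A B" "h \<in> Hom C A B" "Plus C f g = Plus C f h"
  shows "g = h"
proof -
  obtain n where n: "n \<in> Hom C A B" "Plus C f n = Zero C A B" using ex_Neg assms by blast
  have "Plus C (Plus C n f) g = Plus C (Plus C n f) h" using n assms by (simp add: Plus_assoc)
  with n assms show ?thesis by (simp add: Plus_comm[of n] Zero_Plus)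
qed

lemma Zero_Comp:
  assumes "f \<in> Hom C A B" "D \<in> Ob C"
  shows "Zero C B D \<cdot> f = Zero C A D"
proof -
  have z: "Zero C B D \<in> Hom C B D" "Zero C A D \<in> Hom C A D"
    using assms Zero_closed Hom_ObD by auto
  have c: "Zero C B D \<cdot> f \<in> Hom C A D" using Comp_closed assms z by blast
  have "Plus C (Zero C B D \<cdot> f) (Zero C B D \<cdot> f) = Plus C (Zero C B D \<cdot> f) (Zero C A D)"
    using Comp_Plus_left[OF assms(1) z(1) z(1)] by (simp add: Zero_Plus[OF z(1)] Plus_Zero[OF c])
  then show ?thesis using Plus_cancel c z by blast
qed

lemma Comp_Zero:
  assumes "g \<in> Hom C B D" "A \<in> Ob C"
  shows "g \<cdot> Zero C A B = Zero C A D"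
proof -
  have z: "Zero C A B \<in> Hom C A B" "Zero C A D \<in> Hom C A D"
    using assms Zero_closed Hom_ObD by auto
  have c: "g \<cdot> Zero C A B \<in> Hom C A D" using Comp_closed assms z by blast
  have "Plus C (g \<cdot> Zero C A B) (g \<cdot> Zero C A B) = Plus C (g \<cdot> Zero C A B) (Zero C A D)"
    using Comp_Plus_right[OF z(1) z(1) assms(1)] by (simp add: Zero_Plus[OF z(1)] Plus_Zero[OF c])
  then show ?thesis using Plus_cancel c z by blast
qed

subsection \<open>Biproducts\<close>

lemma is_biproductD:
  assumes "is_biproduct C A B S i j p q"
  shows "i \<in> Hom C A S" "j \<in> Hom C B S" "p \<in> Hom C S A" "q \<in> Hom C S B"
    "p \<cdot> i = Ident C A" "q \<cdot> j = Ident C B" "q \<cdot> i = Zero C A B" "p \<cdot> j = Zero C B A"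
    "Plus C (i \<cdot> p) (j \<cdot> q) = Ident C S"
  using assms by (auto simp: is_biproduct_def)

text \<open>The map \<open>?g\<close> matches the projections, \<open>p \<cdot> ?g = p'\<close> and
  \<open>q \<cdot> ?g = q'\<close>, which turns the composite into the sum representing
  \<open>Ident C S'\<close>. Exchanging the two biproducts gives the other composite, so this single
  identity yields uniqueness of biproducts up to isomorphism.\<close>

lemma biproduct_comparison:
  assumes "is_biproduct C A B S i j p q" "is_biproduct C A B S' i' j' p' q'"
  shows "Plus C (i' \<cdot> p) (j' \<cdot> q) \<cdot> Plus C (i \<cdot> p') (j \<cdot> q') = Ident C S'"
proof -
  note b = is_biproductD[OF assms(1)] and b' = is_biproductD[OF assms(2)]
  note cl = Comp_closed Plus_closed
  let ?g = "Plus C (i \<cdot> p') (j \<cdot> q')"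
  have o: "A \<in> Ob C" "B \<in> Ob C" using Hom_ObD b by blast+
  have h: "i \<cdot> p' \<in> Hom C S' S" "j \<cdot> q' \<in> Hom C S' S" using b b' cl by blast+
  have g: "?g \<in> Hom C S' S" using h cl by blast
  have pg: "p \<cdot> ?g = p'"
  proof -
    have "p \<cdot> ?g = Plus C (p \<cdot> (i \<cdot> p')) (p \<cdot> (j \<cdot> q'))" using Comp_Plus_right h b by blast
    also have "\<dots> = Plus C ((p \<cdot> i) \<cdot> p') ((p \<cdot> j) \<cdot> q')"
      using Comp_assoc[OF b'(3) b(1) b(3)] Comp_assoc[OF b'(4) b(2) b(3)] by simp
    also have "\<dots> = p'"
      using b b' o by (simp add: Ident_Comp[OF b'(3)] Zero_Comp[OF b'(4)] Plus_Zero[OF b'(3)])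
    finally show ?thesis .
  qed
  have qg: "q \<cdot> ?g = q'"
  proof -
    have "q \<cdot> ?g = Plus C (q \<cdot> (i \<cdot> p')) (q \<cdot> (j \<cdot> q'))" using Comp_Plus_right h b by blast
    also have "\<dots> = Plus C ((q \<cdot> i) \<cdot> p') ((q \<cdot> j) \<cdot> q')"
      using Comp_assoc[OF b'(3) b(1) b(4)] Comp_assoc[OF b'(4) b(2) b(4)] by simp
    also have "\<dots> = q'"
      using b b' o by (simp add: Ident_Comp[OF b'(4)] Zero_Comp[OF b'(3)] Zero_Plus[OF b'(4)])
    finally show ?thesis .
  qed
  have h': "i' \<cdot> p \<in> Hom C S S'" "j' \<cdot> q \<in> Hom C S S'" using b b' cl by blast+
  have "Plus C (i' \<cdot> p) (j' \<cdot> q) \<cdot> ?g = Plus C ((i' \<cdot> p) \<cdot> ?g) ((j' \<cdot> q) \<cdot> ?g)"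
    using Comp_Plus_left g h' by blast
  also have "\<dots> = Plus C (i' \<cdot> p') (j' \<cdot> q')"
    using Comp_assoc[OF g b(3) b'(1)] Comp_assoc[OF g b(4) b'(2)] pg qg by simp
  finally show ?thesis using b' by simp
qed

lemma biproduct_unique:
  assumes "is_biproduct C A B S i j p q" "is_biproduct C A B S' i' j' p' q'"
  shows "is_iso C S S' (Plus C (i' \<cdot> p) (j' \<cdot> q))"
proof -
  note b = is_biproductD[OF assms(1)] and b' = is_biproductD[OF assms(2)]
  have "Plus C (i' \<cdot> p) (j' \<cdot> q) \<in> Hom C S S'" "Plus C (i \<cdot> p') (j \<cdot> q') \<in> Hom C S' S"
    using b b' Comp_closed Plus_closed by blast+
  then show ?thesis
    unfolding is_iso_def
    using biproduct_comparison[OF assms] biproduct_comparison[OF assms(2,1)] by blast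
qed

text \<open>Hall numbers refer to chosen representatives, whereas a decomposition produces arbitrary
  summands; transporting the structure maps along isomorphisms passes from one to the other.\<close>

lemma biproduct_iso:
  assumes b: "is_biproduct C A B S i j p q" and f: "is_iso C A A' f" and g: "is_iso C B B' g"
  shows "\<exists>i j p q. is_biproduct C A' B' S i j p q"
proof -
  note b = is_biproductD[OF b]
  obtain f' where f: "f \<in> Hom C A A'" "f' \<in> Hom C A' A" "f' \<cdot> f = Ident C A" "f \<cdot> f' = Ident C A'"
    using f by (auto simp: is_iso_def)
  obtain g' where g: "g \<in> Hom C B B'" "g' \<in> Hom C B' B" "g' \<cdot> g = Ident C B" "g \<cdot> g' = Ident C B'"
    using g by (auto simp: is_iso_def)
  \<comment> \<open>Every composite below is fourfold, and its inner pair is what simplifies; this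
    regrouping exposes that pair.\<close>
  have mid: "(v \<cdot> u) \<cdot> (s \<cdot> t) = v \<cdot> ((u \<cdot> s) \<cdot> t)"
    if "t \<in> Hom C D1 D2" "s \<in> Hom C D2 D3" "u \<in> Hom C D3 D4" "v \<in> Hom C D4 D5" for t s u v D1 D2 D3 D4 D5
    using Comp_assoc[OF Comp_closed[OF that(1,2)] that(3,4)] Comp_assoc[OF that(1-3)] by simp
  have o: "A' \<in> Ob C" "B' \<in> Ob C" "A \<in> Ob C" "B \<in> Ob C" using f g Hom_ObD by blast+
  have "is_biproduct C A' B' S (i \<cdot> f') (j \<cdot> g') (f \<cdot> p) (g \<cdot> q)"
    unfolding is_biproduct_def
  proof (intro conjI)
    show "i \<cdot> f' \<in> Hom C A' S" "j \<cdot> g' \<in> Hom C B' S" "f \<cdot> p \<in> Hom C S A'" "g \<cdot> q \<in> Hom C S B'"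
      using b f g Comp_closed by blast+
    show "f \<cdot> p \<cdot> (i \<cdot> f') = Ident C A'"
      using mid[OF f(2) b(1) b(3) f(1)] b f by (simp add: Ident_Comp[OF f(2)])
    show "g \<cdot> q \<cdot> (j \<cdot> g') = Ident C B'"
      using mid[OF g(2) b(2) b(4) g(1)] b g by (simp add: Ident_Comp[OF g(2)])
    show "g \<cdot> q \<cdot> (i \<cdot> f') = Zero C A' B'"
      using mid[OF f(2) b(1) b(4) g(1)] b o by (simp add: Zero_Comp[OF f(2)] Comp_Zero[OF g(1)])
    show "f \<cdot> p \<cdot> (j \<cdot> g') = Zero C B' A'"
      using mid[OF g(2) b(2) b(3) f(1)] b o by (simp add: Zero_Comp[OF g(2)] Comp_Zero[OF f(1)])
    show "Plus C (i \<cdot> f' \<cdot> (f \<cdot> p)) (j \<cdot> g' \<cdot> (g \<cdot> q)) = Ident C S"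
      using mid[OF b(3) f(1) f(2) b(1)] mid[OF b(4) g(1) g(2) b(2)] b f g
      by (simp add: Ident_Comp[OF b(3)] Ident_Comp[OF b(4)])
  qed
  then show ?thesis by blast
qed

text \<open>The splitting lemma: the complement \<open>d\<close> of the idempotent
  \<open>i \<cdot> r\<close> kills \<open>i\<close>, hence factors through the cokernel
  \<open>p\<close>, and the factor \<open>s\<close> is the missing injection.\<close>

lemma biproduct_of_retraction:
  assumes k: "is_kernel C A Y B i p" and c: "is_cokernel C A Y B i p"
    and r: "r \<in> Hom C Y A" "r \<cdot> i = Ident C A"
  shows "\<exists>s. is_biproduct C A B Y i s r p"
proof -
  have i: "i \<in> Hom C A Y" and p: "p \<in> Hom C Y B" and pi: "p \<cdot> i = Zero C A B"
    using k by (auto simp: is_kernel_def)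
  have o: "A \<in> Ob C" "B \<in> Ob C" "Y \<in> Ob C" using i p Hom_ObD by blast+
  have ir: "i \<cdot> r \<in> Hom C Y Y" using i r Comp_closed by blast
  obtain d where d: "d \<in> Hom C Y Y" "Ident C Y = Plus C (i \<cdot> r) d"
    using ex_diff[OF Ident_closed ir] o by blast
  have di: "d \<cdot> i \<in> Hom C A Y" using d i Comp_closed by blast
  have "Plus C i (d \<cdot> i) = Plus C i (Zero C A Y)"
  proof -
    have "Plus C i (d \<cdot> i) = Plus C (i \<cdot> r \<cdot> i) (d \<cdot> i)"
      by (simp add: Comp_assoc[OF i r(1) i] r Comp_Ident[OF i])
    also have "\<dots> = i" using Comp_Plus_left[OF i ir d(1)] by (simp add: d(2)[symmetric] Ident_Comp[OF i])
    finally show ?thesis using Plus_Zero[OF i] by simp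
  qed
  then have "d \<cdot> i = Zero C A Y" using Plus_cancel[OF i di Zero_closed] o by blast
  then obtain s where s: "s \<in> Hom C B Y" "s \<cdot> p = d"
    using c d(1) o unfolding is_cokernel_def by blast
  \<comment> \<open>Uniqueness in the cokernel property makes \<open>p\<close> epic, so both
    equations for \<open>s\<close> can be tested after composing with \<open>p\<close>.\<close>
  have epi: "u = v" if "u \<in> Hom C B T" "v \<in> Hom C B T" "u \<cdot> p = v \<cdot> p" for u v T
  proof -
    have "T \<in> Ob C" using that Hom_ObD by blast
    moreover have "u \<cdot> p \<in> Hom C Y T" "(u \<cdot> p) \<cdot> i = Zero C A T"
      using that p Comp_closed Comp_assoc[OF i p that(1)] pi Comp_Zero[OF that(1)] o by auto
    ultimately show ?thesis using c that unfolding is_cokernel_def by metis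
  qed
  have ps: "p \<cdot> s \<in> Hom C B B" and rs: "r \<cdot> s \<in> Hom C B A" using p s r Comp_closed by blast+
  have pd: "p \<cdot> d \<in> Hom C Y B" and rd: "r \<cdot> d \<in> Hom C Y A" using p d r Comp_closed by blast+
  have "p \<cdot> s \<cdot> p = p \<cdot> d" using Comp_assoc[OF p s(1) p] s by simp
  also have "\<dots> = Plus C (p \<cdot> (i \<cdot> r)) (p \<cdot> d)"
    using Comp_assoc[OF r(1) i p] pi Zero_Comp[OF r(1)] o Zero_Plus[OF pd] by simp
  also have "\<dots> = p" using Comp_Plus_right[OF ir d(1) p] d Comp_Ident[OF p] by simp
  finally have 1: "p \<cdot> s = Ident C B"
    using epi[OF ps Ident_closed] o Ident_Comp[OF p] by simp
  \<comment> \<open>Expanding \<open>r\<close> composed with the identity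
    \<open>i \<cdot> r + d\<close> gives \<open>r + r \<cdot> d = r\<close>, and cancelling
    \<open>r\<close> leaves \<open>r \<cdot> d = 0\<close>.\<close>
  have "Plus C r (r \<cdot> d) = Plus C (r \<cdot> (i \<cdot> r)) (r \<cdot> d)"
    using Comp_assoc[OF r(1) i r(1)] r Ident_Comp[OF r(1)] by simp
  also have "\<dots> = r" using Comp_Plus_right[OF ir d(1) r(1)] d Comp_Ident[OF r(1)] by simp
  also have "\<dots> = Plus C r (Zero C Y A)" using Plus_Zero r by simp
  finally have "r \<cdot> d = Zero C Y A" using Plus_cancel[OF r(1) rd Zero_closed] o by blast
  then have "r \<cdot> s \<cdot> p = Zero C B A \<cdot> p"
    using Comp_assoc[OF p s(1) r(1)] s Zero_Comp[OF p] o by simp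
  then have 2: "r \<cdot> s = Zero C B A" using epi[OF rs Zero_closed] o by blast
  show ?thesis using i p r s pi 1 2 d unfolding is_biproduct_def by auto
qed

subsection \<open>Counting morphisms\<close>

text \<open>Left exactness of Hom(T,-): each nonempty fibre of composition with \<open>p\<close> is
  a coset of the image of Hom(T,A), and there are at most as many fibres as elements of
  Hom(T,B).\<close>

lemma card_Hom_kernel:
  assumes h: "hom_finite C" and k: "is_kernel C A Y B i p" and T: "T \<in> Ob C"
  shows "card (Hom C T Y) \<le> card (Hom C T A) * card (Hom C T B)"
proof -
  have i: "i \<in> Hom C A Y" and p: "p \<in> Hom C Y B" and pi: "p \<cdot> i = Zero C A B"
    using k by (auto simp: is_kernel_def)
  have o: "A \<in> Ob C" "B \<in> Ob C" "Y \<in> Ob C" using i p Hom_ObD by blast+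
  have fin: "finite (Hom C T Y)" "finite (Hom C T A)" "finite (Hom C T B)"
    using h o T by (auto simp: hom_finite_def)
  have "card {y \<in> Hom C T Y. p \<cdot> y = p \<cdot> x} \<le> card (Hom C T A)" if x: "x \<in> Hom C T Y" for x
  proof -
    have "{y \<in> Hom C T Y. p \<cdot> y = p \<cdot> x} \<subseteq> (\<lambda>w. Plus C x (i \<cdot> w)) ` Hom C T A"
    proof clarify
      fix y assume y: "y \<in> Hom C T Y" "p \<cdot> y = p \<cdot> x"
      obtain d where d: "d \<in> Hom C T Y" "y = Plus C x d" using ex_diff y x by blast
      have pc: "p \<cdot> x \<in> Hom C T B" "p \<cdot> d \<in> Hom C T B" using p x d Comp_closed by blast+
      have "Plus C (p \<cdot> x) (p \<cdot> d) = Plus C (p \<cdot> x) (Zero C T B)"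
        using Comp_Plus_right[OF x d(1) p] d y Plus_Zero[OF pc(1)] by simp
      then have "p \<cdot> d = Zero C T B" using Plus_cancel[OF pc] Zero_closed T o by blast
      then obtain w where "w \<in> Hom C T A" "i \<cdot> w = d"
        using k T d(1) unfolding is_kernel_def by blast
      then show "y \<in> (\<lambda>w. Plus C x (i \<cdot> w)) ` Hom C T A" using d by blast
    qed
    with fin show ?thesis by (intro surj_card_le) auto
  qed
  from card_le_fibres[OF fin(1) this]
  have "card (Hom C T Y) \<le> card (Hom C T A) * card ((\<lambda>y. p \<cdot> y) ` Hom C T Y)" .
  also have "\<dots> \<le> card (Hom C T A) * card (Hom C T B)"
    using fin Comp_closed[OF _ p] by (intro mult_le_mono2 card_mono) auto
  finally show ?thesis .
qed

text \<open>The dual count for Hom(-,T). The image of restriction along \<open>i\<close> is kept as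
  a factor, because the strict inequality for nonsplit extensions comes from this image being a
  proper subset.\<close>

lemma card_Hom_cokernel:
  assumes h: "hom_finite C" and c: "is_cokernel C A Y B i p" and T: "T \<in> Ob C"
  shows "card (Hom C Y T) \<le> card (Hom C B T) * card ((\<lambda>u. u \<cdot> i) ` Hom C Y T)"
proof -
  have i: "i \<in> Hom C A Y" and p: "p \<in> Hom C Y B"
    using c by (auto simp: is_cokernel_def)
  have o: "A \<in> Ob C" "B \<in> Ob C" "Y \<in> Ob C" using i p Hom_ObD by blast+
  have fin: "finite (Hom C Y T)" "finite (Hom C B T)"
    using h o T by (auto simp: hom_finite_def)
  have "card {y \<in> Hom C Y T. y \<cdot> i = x \<cdot> i} \<le> card (Hom C B T)" if x: "x \<in> Hom C Y T" for x
  proof -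
    have "{y \<in> Hom C Y T. y \<cdot> i = x \<cdot> i} \<subseteq> (\<lambda>w. Plus C x (w \<cdot> p)) ` Hom C B T"
    proof clarify
      fix y assume y: "y \<in> Hom C Y T" "y \<cdot> i = x \<cdot> i"
      obtain d where d: "d \<in> Hom C Y T" "y = Plus C x d" using ex_diff y x by blast
      have pc: "x \<cdot> i \<in> Hom C A T" "d \<cdot> i \<in> Hom C A T" using i x d Comp_closed by blast+
      have "Plus C (x \<cdot> i) (d \<cdot> i) = Plus C (x \<cdot> i) (Zero C A T)"
        using Comp_Plus_left[OF i x d(1)] d y Plus_Zero[OF pc(1)] by simp
      then have "d \<cdot> i = Zero C A T" using Plus_cancel[OF pc] Zero_closed T o by blast
      then obtain w where "w \<in> Hom C B T" "w \<cdot> p = d"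
        using c T d(1) unfolding is_cokernel_def by blast
      then show "y \<in> (\<lambda>w. Plus C x (w \<cdot> p)) ` Hom C B T" using d by blast
    qed
    with fin show ?thesis by (intro surj_card_le) auto
  qed
  from card_le_fibres[OF fin(1) this] show ?thesis .
qed

lemma card_Hom_cokernel':
  assumes h: "hom_finite C" and c: "is_cokernel C A Y B i p" and T: "T \<in> Ob C"
  shows "card (Hom C Y T) \<le> card (Hom C B T) * card (Hom C A T)"
proof -
  have i: "i \<in> Hom C A Y" using c by (auto simp: is_cokernel_def)
  then have "card ((\<lambda>u. u \<cdot> i) ` Hom C Y T) \<le> card (Hom C A T)"
    using h T Hom_ObD Comp_closed by (intro card_mono) (auto simp: hom_finite_def)
  then show ?thesis using card_Hom_cokernel[OF assms] by (meson mult_le_mono2 order_trans)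
qed

text \<open>Endomorphisms of a biproduct are 2x2 matrices of morphisms; the bound follows since
  every matrix is realised.\<close>

lemma card_End_biproduct:
  assumes h: "hom_finite C" and b: "is_biproduct C A B S i j p q"
  shows "card (Hom C A A) * card (Hom C B A) * (card (Hom C A B) * card (Hom C B B))
    \<le> card (Hom C S S)"
proof -
  note b = is_biproductD[OF b]
  have o: "A \<in> Ob C" "B \<in> Ob C" "S \<in> Ob C" using b Hom_ObD by blast+
  let ?H = "Hom C A A \<times> Hom C B A \<times> Hom C A B \<times> Hom C B B"
  let ?\<phi> = "\<lambda>f. (p \<cdot> f \<cdot> i, p \<cdot> f \<cdot> j, q \<cdot> f \<cdot> i, q \<cdot> f \<cdot> j)"
  have "?H \<subseteq> ?\<phi> ` Hom C S S"
  proof clarify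
    fix a c d e assume m: "a \<in> Hom C A A" "c \<in> Hom C B A" "d \<in> Hom C A B" "e \<in> Hom C B B"
    let ?u = "Plus C (a \<cdot> p) (c \<cdot> q)" and ?v = "Plus C (d \<cdot> p) (e \<cdot> q)"
    have mc: "a \<cdot> p \<in> Hom C S A" "c \<cdot> q \<in> Hom C S A" "d \<cdot> p \<in> Hom C S B" "e \<cdot> q \<in> Hom C S B"
      using b m Comp_closed by blast+
    then have uv: "?u \<in> Hom C S A" "?v \<in> Hom C S B" using Plus_closed by blast+
    have iu: "i \<cdot> ?u \<in> Hom C S S" "j \<cdot> ?v \<in> Hom C S S" using uv b Comp_closed by blast+
    \<comment> \<open>The rows of the matrix are \<open>?u\<close>, into \<open>A\<close>, and
      \<open>?v\<close>, into \<open>B\<close>; \<open>?f\<close> reassembles them.\<close>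
    let ?f = "Plus C (i \<cdot> ?u) (j \<cdot> ?v)"
    have f: "?f \<in> Hom C S S" using iu Plus_closed by blast
    have pf: "p \<cdot> ?f = ?u"
      using Comp_Plus_right[OF iu b(3)] Comp_assoc[OF uv(1) b(1) b(3)] Comp_assoc[OF uv(2) b(2) b(3)]
        Ident_Comp[OF uv(1)] Zero_Comp[OF uv(2)] Plus_Zero[OF uv(1)] b o by simp
    have qf: "q \<cdot> ?f = ?v"
      using Comp_Plus_right[OF iu b(4)] Comp_assoc[OF uv(1) b(1) b(4)] Comp_assoc[OF uv(2) b(2) b(4)]
        Ident_Comp[OF uv(2)] Zero_Comp[OF uv(1)] Zero_Plus[OF uv(2)] b o by simp
    have "?u \<cdot> i = a"
      using Comp_Plus_left[OF b(1) mc(1,2)] Comp_assoc[OF b(1) b(3) m(1)] Comp_assoc[OF b(1) b(4) m(2)]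
        Comp_Ident[OF m(1)] Comp_Zero[OF m(2) o(1)] Plus_Zero[OF m(1)] b(5,7) by simp
    moreover have "?u \<cdot> j = c"
      using Comp_Plus_left[OF b(2) mc(1,2)] Comp_assoc[OF b(2) b(3) m(1)] Comp_assoc[OF b(2) b(4) m(2)]
        Comp_Ident[OF m(2)] Comp_Zero[OF m(1) o(2)] Zero_Plus[OF m(2)] b(6,8) by simp
    moreover have "?v \<cdot> i = d"
      using Comp_Plus_left[OF b(1) mc(3,4)] Comp_assoc[OF b(1) b(3) m(3)] Comp_assoc[OF b(1) b(4) m(4)]
        Comp_Ident[OF m(3)] Comp_Zero[OF m(4) o(1)] Plus_Zero[OF m(3)] b(5,7) by simp
    moreover have "?v \<cdot> j = e"
      using Comp_Plus_left[OF b(2) mc(3,4)] Comp_assoc[OF b(2) b(3) m(3)] Comp_assoc[OF b(2) b(4) m(4)]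
        Comp_Ident[OF m(4)] Comp_Zero[OF m(3) o(2)] Zero_Plus[OF m(4)] b(6,8) by simp
    ultimately show "(a, c, d, e) \<in> ?\<phi> ` Hom C S S"
      using f pf qf by (intro image_eqI[of _ _ ?f]) simp_all
  qed
  then have "card ?H \<le> card (Hom C S S)"
    using h o by (intro surj_card_le) (auto simp: hom_finite_def)
  then show ?thesis by (simp add: card_cartesian_product mult.assoc)
qed

lemma card_End_extension:
  assumes h: "hom_finite C" and k: "is_kernel C A Y B i p" and c: "is_cokernel C A Y B i p"
    and n: "\<nexists>s r. is_biproduct C A B Y i s r p"
  shows "card (Hom C Y Y) < card (Hom C A A) * card (Hom C B A) * (card (Hom C A B) * card (Hom C B B))"
proof -
  have i: "i \<in> Hom C A Y" and p: "p \<in> Hom C Y B"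
    using k by (auto simp: is_kernel_def)
  have o: "A \<in> Ob C" "B \<in> Ob C" "Y \<in> Ob C" using i p Hom_ObD by blast+
  have fin: "finite (Hom C D E)" if "D \<in> Ob C" "E \<in> Ob C" for D E
    using h that by (auto simp: hom_finite_def)
  have pos: "0 < card (Hom C D E)" if "D \<in> Ob C" "E \<in> Ob C" for D E
    using fin[OF that] Zero_closed[OF that] by (auto simp: card_gt_0_iff)
  \<comment> \<open>A preimage of the identity would be a retraction of \<open>i\<close>, and the
    sequence would split.\<close>
  have "Ident C A \<notin> (\<lambda>u. u \<cdot> i) ` Hom C Y A"
    using n biproduct_of_retraction[OF k c] by force
  then have "(\<lambda>u. u \<cdot> i) ` Hom C Y A \<subset> Hom C A A"
    using Ident_closed o i Comp_closed by blast
  then have "card ((\<lambda>u. u \<cdot> i) ` Hom C Y A) < card (Hom C A A)"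
    using fin o by (intro psubset_card_mono) auto
  then have 1: "card (Hom C Y A) < card (Hom C A A) * card (Hom C B A)"
    using card_Hom_cokernel[OF h c o(1)] pos[OF o(2,1)]
    by (metis (no_types, lifting) le_less_trans mult.commute mult_less_cancel1)
  have 2: "card (Hom C Y B) \<le> card (Hom C A B) * card (Hom C B B)"
    using card_Hom_cokernel'[OF h c o(2)] by (simp add: mult.commute)
  have "card (Hom C Y Y) \<le> card (Hom C Y A) * card (Hom C Y B)"
    using card_Hom_kernel[OF h k o(3)] .
  also have "\<dots> < card (Hom C A A) * card (Hom C B A) * (card (Hom C A B) * card (Hom C B B))"
    \<comment> \<open>The strict bound on maps into \<open>A\<close> survives multiplication by the
      weak bound on maps into \<open>B\<close>, since Hom(Y,B) contains the zero map and so has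
      positive cardinality.\<close>
    using 1 2 pos[OF o(3,2)] by (simp add: mult_less_le_imp_less)
  finally show ?thesis .
qed

subsection \<open>Isomorphism classes\<close>

lemma iso_rel_equiv: "equiv (Ob C) (iso_rel C)"
proof (rule equivI)
  show "iso_rel C \<subseteq> Ob C \<times> Ob C" by (auto simp: iso_rel_def)
  show "refl_on (Ob C) (iso_rel C)"
  proof (rule refl_onI)
    fix X assume X: "X \<in> Ob C"
    note Ident_closed[OF X] Comp_Ident[OF Ident_closed[OF X]]
    with X show "(X, X) \<in> iso_rel C" unfolding iso_rel_def is_iso_def by blast
  qed
  show "sym (iso_rel C)"
  proof (rule symI)
    fix X Y assume "(X, Y) \<in> iso_rel C"
    then show "(Y, X) \<in> iso_rel C" unfolding iso_rel_def is_iso_def by blast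
  qed
  show "trans (iso_rel C)"
  proof (rule transI)
    fix X Y Z assume "(X, Y) \<in> iso_rel C" "(Y, Z) \<in> iso_rel C"
    then obtain f f' g g' where o: "X \<in> Ob C" "Z \<in> Ob C"
      and f: "f \<in> Hom C X Y" "f' \<in> Hom C Y X" "f' \<cdot> f = Ident C X" "f \<cdot> f' = Ident C Y"
      and g: "g \<in> Hom C Y Z" "g' \<in> Hom C Z Y" "g' \<cdot> g = Ident C Y" "g \<cdot> g' = Ident C Z"
      unfolding iso_rel_def is_iso_def by blast
    have gf: "g \<cdot> f \<in> Hom C X Z" "f' \<cdot> g' \<in> Hom C Z X" using f g Comp_closed by blast+
    have "f' \<cdot> g' \<cdot> (g \<cdot> f) = Ident C X"
      using Comp_assoc[OF gf(1) g(2) f(2)] Comp_assoc[OF f(1) g(1) g(2)] f g Ident_Comp[OF f(1)] by simp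
    moreover have "g \<cdot> f \<cdot> (f' \<cdot> g') = Ident C Z"
      using Comp_assoc[OF gf(2) f(1) g(1)] Comp_assoc[OF g(2) f(2) f(1)] f g Ident_Comp[OF g(2)] by simp
    ultimately show "(X, Z) \<in> iso_rel C" using o gf unfolding iso_rel_def is_iso_def by blast
  qed
qed

lemma iso_class_rep:
  assumes "x \<in> carrier (Iso C)"
  shows "rep x \<in> Ob C" "iso_class C (rep x) = x"
proof -
  have x: "x \<in> Ob C // iso_rel C" using assms by (simp add: Iso_def)
  then have r: "rep x \<in> x" unfolding rep_def
    using in_quotient_imp_non_empty[OF iso_rel_equiv] by (metis ex_in_conv someI_ex)
  then show "rep x \<in> Ob C" using in_quotient_imp_subset[OF iso_rel_equiv x] by blast
  with x r show "iso_class C (rep x) = x" unfolding iso_class_def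
    by (metis Image_singleton_iff iso_rel_equiv quotientE equiv_class_eq)
qed

lemma iso_class_closed: "X \<in> Ob C \<Longrightarrow> iso_class C X \<in> carrier (Iso C)"
  by (simp add: Iso_def iso_class_def quotientI)

lemma iso_class_eq_iff:
  "X \<in> Ob C \<Longrightarrow> Y \<in> Ob C \<Longrightarrow> iso_class C X = iso_class C Y \<longleftrightarrow> (X, Y) \<in> iso_rel C"
  unfolding iso_class_def by (simp add: eq_equiv_class_iff[OF iso_rel_equiv])

lemma iso_rep:
  assumes "X \<in> Ob C"
  shows "\<exists>f. is_iso C X (rep (iso_class C X)) f"
  using iso_class_rep[OF iso_class_closed[OF assms]] iso_class_eq_iff assms
  by (fastforce simp: iso_rel_def)

lemma zero_object_Hom_unique:
  assumes Z: "is_zero_object C Z"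
  shows "f \<in> Hom C T Z \<Longrightarrow> g \<in> Hom C T Z \<Longrightarrow> f = g"
    and "f \<in> Hom C Z T \<Longrightarrow> g \<in> Hom C Z T \<Longrightarrow> f = g"
proof -
  have ex1: "\<exists>!h. h \<in> Hom C T Z" "\<exists>!h. h \<in> Hom C Z T" if "T \<in> Ob C"
    using Z that unfolding is_zero_object_def by simp_all
  show "f = g" if "f \<in> Hom C T Z" "g \<in> Hom C T Z"
    using ex1(1)[OF Hom_ObD(1)[OF that(1)]] that by metis
  show "f = g" if "f \<in> Hom C Z T" "g \<in> Hom C Z T"
    using ex1(2)[OF Hom_ObD(2)[OF that(1)]] that by metis
qed

lemma zero_object_iso:
  assumes Z: "is_zero_object C Z" and XZ: "(Z, X) \<in> iso_rel C"
  shows "is_zero_object C X"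
  unfolding is_zero_object_def
proof (intro conjI ballI)
  show X: "X \<in> Ob C" using XZ by (simp add: iso_rel_def)
  obtain f g where fg: "f \<in> Hom C Z X" "g \<in> Hom C X Z" "f \<cdot> g = Ident C X"
    using XZ unfolding iso_rel_def is_iso_def by blast
  fix T assume T: "T \<in> Ob C"
  show "\<exists>!h. h \<in> Hom C T X"
  proof (intro ex1I)
    show "Zero C T X \<in> Hom C T X" by (rule Zero_closed[OF T X])
    fix h assume h: "h \<in> Hom C T X"
    \<comment> \<open>Any two maps into \<open>Z\<close> agree, and composing with \<open>f\<close>
      afterwards undoes \<open>g\<close>.\<close>
    have "g \<cdot> h = g \<cdot> Zero C T X"
      by (rule zero_object_Hom_unique(1)[OF Z Comp_closed[OF h fg(2)] Comp_closed[OF Zero_closed[OF T X] fg(2)]])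
    then have "f \<cdot> g \<cdot> h = f \<cdot> g \<cdot> Zero C T X"
      using Comp_assoc[OF h fg(2) fg(1)] Comp_assoc[OF Zero_closed[OF T X] fg(2) fg(1)] by simp
    then show "h = Zero C T X"
      using fg(3) Ident_Comp[OF h] Ident_Comp[OF Zero_closed[OF T X]] by simp
  qed
  show "\<exists>!h. h \<in> Hom C X T"
  proof (intro ex1I)
    show "Zero C X T \<in> Hom C X T" by (rule Zero_closed[OF X T])
    fix h assume h: "h \<in> Hom C X T"
    have "h \<cdot> f = Zero C X T \<cdot> f"
      by (rule zero_object_Hom_unique(2)[OF Z Comp_closed[OF fg(1) h] Comp_closed[OF fg(1) Zero_closed[OF X T]]])
    then have "h \<cdot> (f \<cdot> g) = Zero C X T \<cdot> (f \<cdot> g)"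
      using Comp_assoc[OF fg(2) fg(1) h] Comp_assoc[OF fg(2) fg(1) Zero_closed[OF X T]] by simp
    then show "h = Zero C X T"
      using fg(3) Comp_Ident[OF h] Comp_Ident[OF Zero_closed[OF X T]] by simp
  qed
qed

lemma zero_objects_iso:
  assumes Z: "is_zero_object C Z" "is_zero_object C Z'"
  shows "(Z, Z') \<in> iso_rel C"
proof -
  have o: "Z \<in> Ob C" "Z' \<in> Ob C" using assms by (simp_all add: is_zero_object_def)
  let ?f = "Zero C Z Z'" and ?g = "Zero C Z' Z"
  have fg: "?f \<in> Hom C Z Z'" "?g \<in> Hom C Z' Z" using o Zero_closed by simp_all
  have "?g \<cdot> ?f = Ident C Z"
    by (rule zero_object_Hom_unique(1)[OF Z(1) Comp_closed[OF fg] Ident_closed[OF o(1)]])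
  moreover have "?f \<cdot> ?g = Ident C Z'"
    by (rule zero_object_Hom_unique(1)[OF Z(2) Comp_closed[OF fg(2,1)] Ident_closed[OF o(2)]])
  ultimately show ?thesis using fg o unfolding iso_rel_def is_iso_def by blast
qed

text \<open>The unit of \<open>Iso C\<close> is defined as the set of all zero objects; these form
  exactly one isomorphism class, being mutually isomorphic and closed under isomorphism.\<close>

lemma iso_class_zero_iff:
  assumes "X \<in> Ob C"
  shows "iso_class C X = \<one>\<^bsub>Iso C\<^esub> \<longleftrightarrow> is_zero_object C X"
proof
  assume "iso_class C X = \<one>\<^bsub>Iso C\<^esub>"
  moreover have "X \<in> iso_class C X"
    using equiv_class_self[OF iso_rel_equiv assms] by (simp add: iso_class_def)
  ultimately show "is_zero_object C X" by (simp add: Iso_def)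
next
  assume X: "is_zero_object C X"
  have "(X, Z) \<in> iso_rel C \<longleftrightarrow> is_zero_object C Z" for Z
    using zero_objects_iso[OF X] zero_object_iso[OF X] by blast
  then show "iso_class C X = \<one>\<^bsub>Iso C\<^esub>" by (simp add: Iso_def iso_class_def Image_def)
qed

end

section \<open>Extensions in exact categories\<close>

context exact_category
begin

text \<open>The axiom on \<open>SES\<close> speaks of some three objects; sources and targets of
  \<open>i\<close> and \<open>p\<close> force them to be the given ones.\<close>

lemma ses_setD:
  assumes "(i, p) \<in> ses_set C A B X"
  shows "is_kernel C B X A i p" "is_cokernel C B X A i p"
proof -
  obtain A' B' X' where k: "is_kernel C B' X' A' i p" "is_cokernel C B' X' A' i p"
    using SES_kernel_cokernel assms by (fastforce simp: ses_set_def)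
  have "i \<in> Hom C B X" "p \<in> Hom C X A" "i \<in> Hom C B' X'" "p \<in> Hom C X' A'"
    using assms k by (auto simp: ses_set_def is_kernel_def)
  then have "B' = B" "X' = X" "A' = A" by (auto simp: Hom_def)
  with k show "is_kernel C B X A i p" "is_cokernel C B X A i p" by auto
qed

text \<open>If a sequence with middle term \<open>Y\<close> split, uniqueness of biproducts would
  identify \<open>Y\<close> with \<open>S\<close>; hence the strict bound for nonsplit extensions
  applies.\<close>

lemma card_End_less_biproduct:
  assumes h: "hom_finite C" and b: "is_biproduct C A B S i j p q"
    and Y: "ses_set C B A Y \<noteq> {}" and n: "(Y, S) \<notin> iso_rel C"
  shows "card (Hom C Y Y) < card (Hom C S S)"
proof -
  obtain i' p' where s: "(i', p') \<in> ses_set C B A Y" using Y by fast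
  have o: "Y \<in> Ob C" "S \<in> Ob C" using ses_setD(1)[OF s] is_biproductD[OF b] Hom_ObD
    by (auto simp: is_kernel_def)
  have "\<nexists>s r. is_biproduct C A B Y i' s r p'"
  proof clarify
    fix s r assume "is_biproduct C A B Y i' s r p'"
    from biproduct_unique[OF this b] show False using n o by (auto simp: iso_rel_def)
  qed
  from card_End_extension[OF h ses_setD[OF s] this] card_End_biproduct[OF h b]
  show ?thesis by linarith
qed

section \<open>Finiteness and nonvanishing of Hall numbers\<close>

lemma finite_ses_set:
  assumes "hom_finite C"
  shows "finite (ses_set C A B X)"
proof (cases "ses_set C A B X = {}")
  case False
  then have "A \<in> Ob C" "B \<in> Ob C" "X \<in> Ob C" using Hom_ObD by (fastforce simp: ses_set_def)+
  then have "finite (Hom C B X \<times> Hom C X A)" using assms by (auto simp: hom_finite_def)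
  then show ?thesis by (rule finite_subset[rotated]) (auto simp: ses_set_def)
qed simp

lemma card_Aut_pos:
  assumes "hom_finite C" "A \<in> Ob C"
  shows "0 < card (Aut C A)"
proof -
  have "Ident C A \<in> Aut C A"
    using Ident_closed[OF assms(2)] Comp_Ident[OF Ident_closed[OF assms(2)]]
    unfolding Aut_def is_iso_def by auto
  moreover have "finite (Aut C A)"
    using assms by (intro finite_subset[of "Aut C A" "Hom C A A"]) (auto simp: Aut_def is_iso_def hom_finite_def)
  ultimately show ?thesis by (auto simp: card_gt_0_iff)
qed

text \<open>The coproduct coefficient at \<open>(a, b)\<close> counts sequences with subobject
  \<open>a\<close> and quotient \<open>b\<close>. Finiteness rules out the default values: the
  automorphism groups have positive cardinality, and a nonempty set of sequences does not get
  cardinality 0.\<close>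

lemma hall_coF_nonzero_iff:
  assumes "hom_finite C" "a \<in> carrier (Iso C)" "b \<in> carrier (Iso C)" "c \<in> carrier (Iso C)"
  shows "hall_coF C a b c \<noteq> 0 \<longleftrightarrow> ses_set C (rep b) (rep a) (rep c) \<noteq> {}"
  using card_Aut_pos[OF assms(1) iso_class_rep(1)[OF assms(2)]]
    card_Aut_pos[OF assms(1) iso_class_rep(1)[OF assms(3)]]
    card_Aut_pos[OF assms(1) iso_class_rep(1)[OF assms(4)]] finite_ses_set[OF assms(1)]
  by (simp add: hall_coF_def hall_F_def)

text \<open>Cofinitarity lists pairs as (quotient, subobject), the coproduct as (subobject,
  quotient); hence the swap.\<close>

lemma finite_hall_coF_support:
  assumes "cofinitary C" "c \<in> carrier (Iso C)"
  shows "finite {(a, b). a \<in> carrier (Iso C) \<and> b \<in> carrier (Iso C) \<and> hall_coF C a b c \<noteq> 0}"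
proof (rule finite_subset)
  let ?E = "{(iso_class C A, iso_class C B) | A B.
        A \<in> Ob C \<and> B \<in> Ob C \<and> iso_class C (rep c) \<in> Ext1 C A B}"
  have h: "hom_finite C" using assms by (simp add: cofinitary_def)
  show "finite (prod.swap ` ?E)"
    using assms(1) iso_class_rep(1)[OF assms(2)] unfolding cofinitary_def by blast
  show "{(a, b). a \<in> carrier (Iso C) \<and> b \<in> carrier (Iso C) \<and> hall_coF C a b c \<noteq> 0} \<subseteq> prod.swap ` ?E"
  proof clarify
    fix a b assume ab: "a \<in> carrier (Iso C)" "b \<in> carrier (Iso C)" "hall_coF C a b c \<noteq> 0"
    then have "iso_class C (rep c) \<in> Ext1 C (rep b) (rep a)"
      using hall_coF_nonzero_iff[OF h ab(1,2) assms(2)] iso_class_rep[OF assms(2)]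
      by (auto simp: Ext1_def)
    then have "(b, a) \<in> ?E" using iso_class_rep ab(1,2) by (smt (verit) mem_Collect_eq)
    then show "(a, b) \<in> prod.swap ` ?E" by force
  qed
qed

section \<open>Primitive elements\<close>

lemma lookup_hall_comult:
  assumes cof: "cofinitary C" and v: "v \<in> hall_space C"
    and ab: "a \<in> carrier (Iso C)" "b \<in> carrier (Iso C)"
  shows "Poly_Mapping.lookup (hall_comult C v) (a, b)
    = (\<Sum>c \<in> Poly_Mapping.keys v. Poly_Mapping.lookup v c * hall_coF C a b c)"
proof -
  have "Poly_Mapping.lookup (\<Sum>(a, b) \<in> {(a, b). a \<in> carrier (Iso C) \<and> b \<in> carrier (Iso C) \<and> hall_coF C a b c \<noteq> 0}.
        Poly_Mapping.single (a, b) (hall_coF C a b c)) (a, b) = hall_coF C a b c" (is "?l = _")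
    if "c \<in> Poly_Mapping.keys v" for c
  proof -
    let ?S = "{(a, b). a \<in> carrier (Iso C) \<and> b \<in> carrier (Iso C) \<and> hall_coF C a b c \<noteq> 0}"
    have fin: "finite ?S" using finite_hall_coF_support[OF cof] v that by (auto simp: hall_space_def)
    have "?l = (\<Sum>y \<in> ?S. if y = (a, b) then hall_coF C a b c else 0)"
      unfolding lookup_sum
      by (intro sum.cong refl) (simp add: lookup_single when_def split: prod.split)
    \<comment> \<open>Finiteness of \<open>?S\<close> keeps the sum from defaulting to 0. If
      \<open>(a, b)\<close> lies outside \<open>?S\<close>, its coefficient is 0 and the equation
      still holds.\<close>
    also have "\<dots> = hall_coF C a b c" using fin ab by (subst sum.delta) auto
    finally show ?thesis .
  qed
  then show ?thesis unfolding hall_comult_def lookup_sum lookup_pm_scale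
    by (intro sum.cong) auto
qed

end

lemma lookup_tensor:
  "Poly_Mapping.lookup (tensor v w) (a, b) = Poly_Mapping.lookup v a * Poly_Mapping.lookup w b"
proof -
  have "Poly_Mapping.lookup (tensor v w) (a, b) =
    (\<Sum>x \<in> Poly_Mapping.keys v. \<Sum>y \<in> Poly_Mapping.keys w.
      if x = a then (if y = b then Poly_Mapping.lookup v a * Poly_Mapping.lookup w b else 0) else 0)"
    unfolding tensor_def lookup_sum by (intro sum.cong) (auto simp: lookup_single when_def)
  also have "\<dots> = (\<Sum>x \<in> Poly_Mapping.keys v. if x = a then
      (\<Sum>y \<in> Poly_Mapping.keys w. if y = b then Poly_Mapping.lookup v a * Poly_Mapping.lookup w b else 0) else 0)"
    by (intro sum.cong) auto
  also have "\<dots> = Poly_Mapping.lookup v a * Poly_Mapping.lookup w b"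
    by (auto simp: in_keys_iff)
  finally show ?thesis .
qed

context exact_category
begin

text \<open>Compare coefficients at \<open>(a, b)\<close>: both tensors on the primitive side have a
  factor \<open>hall_one C\<close>, supported at the unit class alone, so they contribute nothing
  there.\<close>

lemma primitive_relation:
  assumes cof: "cofinitary C" and v: "v \<in> primitive_space C"
    and a: "a \<in> carrier (Iso C)" "a \<noteq> \<one>\<^bsub>Iso C\<^esub>" and b: "b \<in> carrier (Iso C)" "b \<noteq> \<one>\<^bsub>Iso C\<^esub>"
  shows "(\<Sum>c \<in> Poly_Mapping.keys v. Poly_Mapping.lookup v c * hall_coF C a b c) = 0"
proof -
  have "(\<Sum>c \<in> Poly_Mapping.keys v. Poly_Mapping.lookup v c * hall_coF C a b c)
      = Poly_Mapping.lookup (tensor v (hall_one C) + tensor (hall_one C) v) (a, b)"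
    using lookup_hall_comult[OF cof _ a(1) b(1), of v] v by (simp add: primitive_space_def)
  also have "\<dots> = 0" using a b by (simp add: lookup_add lookup_tensor hall_one_def lookup_single)
  finally show ?thesis .
qed

text \<open>
  A decomposable \<open>[A \<oplus> B]\<close> of the support with the smallest endomorphism ring is impossible: in the
  relation for \<open>([A], [B])\<close> all other terms of the support would have smaller endomorphism rings.
\<close>

lemma primitive_relations_imp_zero:
  assumes h: "hom_finite C"
    and supp: "Poly_Mapping.keys v \<subseteq> carrier (Iso C) - {\<one>\<^bsub>Iso C\<^esub>}"
    and rel: "\<And>a b. a \<in> carrier (Iso C) \<Longrightarrow> a \<noteq> \<one>\<^bsub>Iso C\<^esub> \<Longrightarrow> b \<in> carrier (Iso C) \<Longrightarrow> b \<noteq> \<one>\<^bsub>Iso C\<^esub> \<Longrightarrow>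
      (\<Sum>c \<in> Poly_Mapping.keys v. Poly_Mapping.lookup v c * hall_coF C a b c) = 0"
    and dec: "\<And>c. c \<in> Poly_Mapping.keys v \<Longrightarrow> \<not> indecomposable C (rep c)"
  shows "v = 0"
proof (rule ccontr)
  assume "v \<noteq> 0"
  let ?e = "\<lambda>c. card (Hom C (rep c) (rep c))"
  have "Poly_Mapping.keys v \<noteq> {}" using \<open>v \<noteq> 0\<close> by simp
  then obtain x where x: "x \<in> Poly_Mapping.keys v" and
    min: "\<And>c. c \<in> Poly_Mapping.keys v \<Longrightarrow> ?e x \<le> ?e c"
    using ex_has_least_nat[of "\<lambda>c. c \<in> Poly_Mapping.keys v" _ ?e] by blast
  have x': "x \<in> carrier (Iso C)" "x \<noteq> \<one>\<^bsub>Iso C\<^esub>" using supp x by auto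
  then have X: "rep x \<in> Ob C" "\<not> is_zero_object C (rep x)"
    using iso_class_rep[OF x'(1)] iso_class_zero_iff by metis+
  then obtain A B i j p q where A: "A \<in> Ob C" "\<not> is_zero_object C A"
    and B: "B \<in> Ob C" "\<not> is_zero_object C B" and bi: "is_biproduct C A B (rep x) i j p q"
    using dec[OF x] unfolding indecomposable_def by blast
  define a b where "a = iso_class C A" and "b = iso_class C B"
  have a: "a \<in> carrier (Iso C)" "a \<noteq> \<one>\<^bsub>Iso C\<^esub>" and b: "b \<in> carrier (Iso C)" "b \<noteq> \<one>\<^bsub>Iso C\<^esub>"
    using A B iso_class_zero_iff iso_class_closed by (auto simp: a_def b_def)
  \<comment> \<open>The decomposition is moved to the representatives that occur in the Hall
    numbers.\<close>
  obtain i j p q where bi: "is_biproduct C (rep a) (rep b) (rep x) i j p q"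
    using biproduct_iso[OF bi] iso_rep[OF A(1)] iso_rep[OF B(1)] unfolding a_def b_def by blast
  note b_i = is_biproductD[OF bi]
  have "(i, q) \<in> SES C"
    using SES_split[OF iso_class_rep(1)[OF a(1)] iso_class_rep(1)[OF b(1)] X(1) bi] .
  then have "(i, q) \<in> ses_set C (rep b) (rep a) (rep x)" using b_i by (simp add: ses_set_def)
  \<comment> \<open>The split sequence makes the coefficient of \<open>x\<close> itself
    nonzero.\<close>
  then have nz: "hall_coF C a b x \<noteq> 0" using hall_coF_nonzero_iff[OF h a(1) b(1) x'(1)] by blast
  have z: "hall_coF C a b c = 0" if c: "c \<in> Poly_Mapping.keys v" "c \<noteq> x" for c
  proof (rule ccontr)
    assume nz: "hall_coF C a b c \<noteq> 0"
    have c': "c \<in> carrier (Iso C)" using c supp by auto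
    have "(rep c, rep x) \<notin> iso_rel C"
      using c(2) iso_class_eq_iff[of "rep c" "rep x"] iso_class_rep[OF c'] iso_class_rep[OF x'(1)] by simp
    moreover have "ses_set C (rep b) (rep a) (rep c) \<noteq> {}"
      using nz hall_coF_nonzero_iff[OF h a(1) b(1) c'] by blast
    ultimately have "?e c < ?e x" using card_End_less_biproduct[OF h bi] by blast
    with min[OF c(1)] show False by simp
  qed
  \<comment> \<open>Only the term at \<open>x\<close> survives, and it is a product of two nonzero
    factors.\<close>
  have "(\<Sum>c \<in> Poly_Mapping.keys v. Poly_Mapping.lookup v c * hall_coF C a b c)
      = Poly_Mapping.lookup v x * hall_coF C a b x"
    using x z by (subst sum.remove[of _ x]) auto
  with rel[OF a b] nz x show False by (simp add: in_keys_iff)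
qed

text \<open>Zero objects have the unit of the Grothendieck monoid as degree, so only nonzero classes
  occur in the support of an element of nonzero degree.\<close>

lemma one_notin_Iso_deg:
  assumes "\<gamma> \<noteq> \<one>\<^bsub>groth_monoid C\<^esub>"
  shows "\<one>\<^bsub>Iso C\<^esub> \<notin> Iso_deg C \<gamma>"
  using assms by (auto simp: Iso_deg_def groth_class_def groth_monoid_def)

end

text \<open>Truncation to the coordinates in \<open>S\<close> is linear, is injective on subspaces
  of \<open>W\<close> by \<open>det\<close>, and takes values in the span of at most
  \<open>card S\<close> basis vectors. The set \<open>V\<close> need not be a subspace; the subspace
  \<open>W\<close> provides room for its span.\<close>

lemma dim_le_card_determining:
  assumes W: "module.subspace pm_scale W" and VW: "V \<subseteq> W" and S: "finite S"
    and det: "\<And>w. w \<in> W \<Longrightarrow> (\<And>s. s \<in> S \<Longrightarrow> Poly_Mapping.lookup w s = 0) \<Longrightarrow> w = 0"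
  shows "vector_space.dim pm_scale V \<le> card S"
proof -
  interpret vector_space_pair pm_scale pm_scale
    by (intro vector_space_pair.intro vector_space_pm_scale)
  define f :: "('a \<Rightarrow>\<^sub>0 rat) \<Rightarrow> ('a \<Rightarrow>\<^sub>0 rat)" where
    "f v = (\<Sum>s \<in> S. pm_scale (Poly_Mapping.lookup v s) (Poly_Mapping.single s 1))" for v
  have lookup_f: "Poly_Mapping.lookup (f v) s = Poly_Mapping.lookup v s" if "s \<in> S" for v s
  proof -
    have "Poly_Mapping.lookup (f v) s = (\<Sum>t \<in> S. if t = s then Poly_Mapping.lookup v s else 0)"
      unfolding f_def lookup_sum by (intro sum.cong) (auto simp: lookup_pm_scale lookup_single when_def)
    then show ?thesis using S that by simp
  qed
  have lin: "Vector_Spaces.linear pm_scale pm_scale f"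
    unfolding Vector_Spaces.linear_iff f_def
    by (simp add: vector_space_pm_scale lookup_add lookup_pm_scale vs1.scale_left_distrib
        sum.distrib vs1.scale_sum_right)
  obtain B where B: "B \<subseteq> V" "vs1.independent B" "card B = vs1.dim V"
    by (rule vs1.basis_exists)
  \<comment> \<open>Injectivity is required on all combinations of the basis, and these stay in
    \<open>W\<close>, where \<open>det\<close> applies.\<close>
  have span: "vs1.span B \<subseteq> W" by (rule vs1.span_minimal[OF subset_trans[OF B(1) VW] W])
  have inj: "inj_on f (vs1.span B)"
    unfolding linear_inj_on_iff_eq_0[OF lin vs1.subspace_span]
  proof (intro ballI impI)
    fix v assume v: "v \<in> vs1.span B" "f v = 0"
    show "v = 0"
      using det[of v] lookup_f[of _ v] v span by auto
  qed
  have "f ` B \<subseteq> vs1.span ((\<lambda>s. Poly_Mapping.single s 1) ` S)"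
    unfolding f_def by (intro image_subsetI vs1.span_sum vs1.span_scale) (simp add: vs1.span_base)
  then have "card (f ` B) \<le> card ((\<lambda>s. Poly_Mapping.single s (1::rat)) ` S)"
    using vs1.independent_span_bound[OF finite_imageI[OF S] linear_independent_injective_image[OF lin B(2) inj]]
    by blast
  also have "\<dots> \<le> card S" using S by (rule card_image_le)
  finally show ?thesis
    using B card_image[OF inj_on_subset[OF inj vs1.span_superset]] by simp
qed

section \<open>The dimension bound in a fixed degree\<close>

context exact_category
begin

lemma dim_primitive_deg_le:
  assumes pro: "profinitary C" and cof: "cofinitary C"
    and \<gamma>: "\<gamma> \<in> carrier (groth_monoid C)" "\<gamma> \<noteq> \<one>\<^bsub>groth_monoid C\<^esub>"
  shows "vector_space.dim pm_scale (primitive_deg C \<gamma>) \<le> card (Ind_deg C \<gamma>)"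
proof -
  interpret vector_space pm_scale by (rule vector_space_pm_scale)
  let ?I = "Iso_deg C \<gamma>"
  have fin: "finite ?I" and h: "hom_finite C" using pro \<gamma> by (auto simp: profinitary_def)
  have I: "?I \<subseteq> carrier (Iso C) - {\<one>\<^bsub>Iso C\<^esub>}"
    using one_notin_Iso_deg[OF \<gamma>(2)] iso_class_closed by (auto simp: Iso_deg_def)
  let ?N = "carrier (Iso C) - {\<one>\<^bsub>Iso C\<^esub>}"
  \<comment> \<open>\<open>W\<close> is the solution space of the relations satisfied by primitive
    elements. Summing over the fixed finite set \<open>?I\<close>, instead of the varying support of
    \<open>v\<close>, makes the conditions visibly linear.\<close>
  define W where "W = {v. Poly_Mapping.keys v \<subseteq> ?I \<and>
    (\<forall>a \<in> ?N. \<forall>b \<in> ?N. (\<Sum>c \<in> ?I. Poly_Mapping.lookup v c * hall_coF C a b c) = 0)}"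
  have sum_I: "(\<Sum>c \<in> ?I. Poly_Mapping.lookup v c * hall_coF C a b c)
      = (\<Sum>c \<in> Poly_Mapping.keys v. Poly_Mapping.lookup v c * hall_coF C a b c)"
    if "Poly_Mapping.keys v \<subseteq> ?I" for v :: "'o set \<Rightarrow>\<^sub>0 rat" and a b
    using that fin by (intro sum.mono_neutral_right) (auto simp: in_keys_iff)
  show ?thesis
  proof (rule dim_le_card_determining)
    show "subspace W"
    proof (rule subspaceI)
      show "0 \<in> W" by (simp add: W_def)
    next
      fix v w assume "v \<in> W" "w \<in> W"
      then show "v + w \<in> W" using Poly_Mapping.keys_add[of v w]
        by (auto simp: W_def lookup_add distrib_right sum.distrib)
    next
      fix r v assume "v \<in> W"
      moreover have "Poly_Mapping.keys (pm_scale r v) \<subseteq> Poly_Mapping.keys v"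
        by (auto simp: in_keys_iff lookup_pm_scale)
      ultimately show "pm_scale r v \<in> W"
        by (auto simp: W_def lookup_pm_scale mult.assoc simp flip: sum_distrib_left)
    qed
    show "primitive_deg C \<gamma> \<subseteq> W"
    proof
      fix v assume "v \<in> primitive_deg C \<gamma>"
      then have "v \<in> primitive_space C" "Poly_Mapping.keys v \<subseteq> ?I" by (simp_all add: primitive_deg_def)
      then show "v \<in> W" using primitive_relation[OF cof] sum_I by (simp add: W_def)
    qed
    show "finite (Ind_deg C \<gamma>)"
      using fin by (rule finite_subset[rotated]) (auto simp: Ind_deg_def)
    fix w assume w: "w \<in> W" and z: "\<And>s. s \<in> Ind_deg C \<gamma> \<Longrightarrow> Poly_Mapping.lookup w s = 0"
    have k: "Poly_Mapping.keys w \<subseteq> ?I" using w by (simp add: W_def)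
    show "w = 0"
    \<comment> \<open>If all coefficients at indecomposable classes vanish, the support consists of
      decomposable classes only.\<close>
    proof (rule primitive_relations_imp_zero[OF h])
      show "Poly_Mapping.keys w \<subseteq> ?N" using k I by blast
      show "\<not> indecomposable C (rep c)" if "c \<in> Poly_Mapping.keys w" for c
      proof
        assume "indecomposable C (rep c)"
        moreover have "c \<in> ?I" "iso_class C (rep c) = c" using that k I iso_class_rep by auto
        ultimately have "c \<in> Ind_deg C \<gamma>" unfolding Ind_deg_def by force
        with z that show False by (simp add: in_keys_iff)
      qed
    qed (use w sum_I[OF k] in \<open>simp add: W_def\<close>)
  qed
qed

end

theorem proposition1p8:
  fixes C :: "('o, 'm) exact_category" and \<gamma> :: "'o set set"
  assumes "exact_category C"
    and "profinitary C"
    and "cofinitary C"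
    and "\<gamma> \<in> carrier (groth_monoid C) - {\<one>\<^bsub>groth_monoid C\<^esub>}"
  shows "mult_deg C \<gamma> \<ge> 0"
  using exact_category.dim_primitive_deg_le[OF assms(1-3)] assms(4) by (simp add: mult_deg_def)

end
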